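(* Let $M$ be an even Coxeter matrix over $[n]$, and let $W_M=F'/R'$ be the associated even Coxeter group, where $F'$ is the free group on $\{s_i\mid i\in[n]\}$ and $R'$ is the normal closure in $F'$ of $\{s_i^2\mid i\in[n]\}\cup\{(s_is_j)^{n(i,j)}(s_js_i)^{-n(i,j)}\mid(i,j)\in\mathcal{B}\}$. Then for each $(i,j)\in\mathcal{B}$ we have $[s_i,(s_js_i)_{2n(i,j)-1}]=1$ in $W_M$, and $$\langle s_i,(s_js_i)_{2n(i,j)-1}\rangle=[s_i,s_j]^{n(i,j)}\bmod[F',R']\in H_2(W_M).$$
   Context: Let $n\ge 1$ and $[n]=\{1,\dots,n\}$. A Coxeter matrix over $[n]$ is a symmetric $n\times n$ matrix $M=(m(i,j))$ with $m(i,i)=1$ and $m(i,j)=m(j,i)\in\{2,3,4,\dots\}\cup\{\infty\}$ for $i\ne j$. It is even if every $m(i,j)$ with $i\neq j$ is an even positive integer or $\infty$. For $M$ even and $i\neq j$, put $n(i,j)=m(i,j)/2$ if $m(i,j)<\infty$ and $n(i,j)=\infty$ otherwise, and set $\mathcal{B}=\{(i,j)\mid 1\le i<j\le n,\ n(i,j)<\infty\}$. The even Coxeter group $W_M$ is generated by $s_i$ ($i\in[n]$) with relations $s_i^2=1$ ($i\in[n]$) and $(s_is_j)^{n(i,j)}=(s_js_i)^{n(i,j)}$ for $(i,j)\in\mathcal{B}$. For elements $g,h$ of a group and $m\ge1$, $(gh)_m=ghgh\cdots$ denotes the alternating product with $m$ letters beginning with $g$ (so $(gh)_1=g$, $(gh)_2=gh$,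 $(gh)_3=ghg$). Commutators are $[g,h]=ghg^{-1}h^{-1}$. Homology is with coefficients in $\mathbb{Z}$. Pontryagin product: for commuting elements $g,h$ of a group $G$, let $\phi\colon\mathbb{Z}\times\mathbb{Z}\to G$ be the homomorphism with $\phi(1,0)=g$, $\phi(0,1)=h$. Then $\langle g,h\rangle=\phi_*((1,0)\wedge(0,1))\in H_2(G)$, where $(1,0)\wedge(0,1)\in H_2(\mathbb{Z}\times\mathbb{Z})$ is the Pontryagin product in the homology ring of the abelian group $\mathbb{Z}\times\mathbb{Z}$; in the normalized bar resolution, $\langle g,h\rangle$ is the class of the cycle $[g|h]-[h|g]$. $H_2(G)$ for $G=F'/R'$ is identified with $(R'\cap[F',F'])/[F',R']$ by the Hopf isomorphism, which sends the class of $\prod_{i=1}^g[x_i,y_i]\in R'$ (with $x_i,y_i\in F'$ having images $g_i,h_i\in G$) to the class of the normalized bar cycle $\sum_{i=1}^g\{[I_{i-1}|g_i]+[I_{i-1}g_i|h_i]-[I_{i-1}g_ih_ig_i^{-1}|g_i]-[I_i|h_i]\}$, where $I_i=[g_1,h_1]\cdots[g_i,h_i]$ and $I_0=1$. *)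

theory Defs
  imports "HOL-Algebra.Algebra" "HOL-Library.Extended_Nat"
begin

section \<open>Free groups and presentations\<close>

text \<open>The free group on \<open>S\<close> consists of the reduced words over the letters
  \<open>(e, x)\<close> with \<open>x \<in> S\<close>, where \<open>(False, x)\<close> stands for \<open>x\<close> and \<open>(True, x)\<close> for its
  inverse. The product of reduced words is the reduced form of their concatenation.\<close>

definition inv_letter :: "bool \<times> 'a \<Rightarrow> bool \<times> 'a" where
  "inv_letter l = (\<not> fst l, snd l)"

definition reduced :: "(bool \<times> 'a) list \<Rightarrow> bool" where
  "reduced w \<longleftrightarrow> (\<forall>k. Suc k < length w \<longrightarrow> w ! Suc k \<noteq> inv_letter (w ! k))"

fun push_letter :: "bool \<times> 'a \<Rightarrow> (bool \<times> 'a) list \<Rightarrow> (bool \<times> 'a) list" where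
  "push_letter l [] = [l]"
| "push_letter l (k # w) = (if k = inv_letter l then w else l # k # w)"

definition free_group :: "'a set \<Rightarrow> (bool \<times> 'a) list monoid" where
  "free_group S =
     \<lparr>carrier = {w. snd ` set w \<subseteq> S \<and> reduced w},
      monoid.mult = (\<lambda>u v. foldr push_letter u v),
      one = []\<rparr>"

definition gen :: "'a \<Rightarrow> (bool \<times> 'a) list" where
  "gen x = [(False, x)]"

definition normal_closure :: "('a, 'b) monoid_scheme \<Rightarrow> 'a set \<Rightarrow> 'a set" where
  "normal_closure G S = \<Inter>{N. N \<lhd> G \<and> S \<subseteq> N}"

definition commutator :: "('a, 'b) monoid_scheme \<Rightarrow> 'a \<Rightarrow> 'a \<Rightarrow> 'a" where
  "commutator G g h = g \<otimes>\<^bsub>G\<^esub> h \<otimes>\<^bsub>G\<^esub> inv\<^bsub>G\<^esub> g \<otimes>\<^bsub>G\<^esub> inv\<^bsub>G\<^esub> h"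

definition commutator_subgroup :: "('a, 'b) monoid_scheme \<Rightarrow> 'a set \<Rightarrow> 'a set \<Rightarrow> 'a set" where
  "commutator_subgroup G H K = generate G {commutator G h k | h k. h \<in> H \<and> k \<in> K}"

text \<open>\<open>alt_prod G g h m\<close> is the alternating product \<open>(gh)\<^sub>m = g h g h \<dots>\<close> with \<open>m\<close> letters.\<close>

fun alt_prod :: "('a, 'b) monoid_scheme \<Rightarrow> 'a \<Rightarrow> 'a \<Rightarrow> nat \<Rightarrow> 'a" where
  "alt_prod G g h 0 = \<one>\<^bsub>G\<^esub>"
| "alt_prod G g h (Suc m) = g \<otimes>\<^bsub>G\<^esub> alt_prod G h g m"


section \<open>Integral homology via the normalized bar complex\<close>

text \<open>The normalized bar symbol \<open>[x\<^sub>1|\<dots>|x\<^sub>k]\<close>, which is zero as soon as some entry is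
  the identity.\<close>

definition bar :: "('a, 'b) monoid_scheme \<Rightarrow> 'a list \<Rightarrow> ('a list \<Rightarrow>\<^sub>0 int)" where
  "bar G xs = (if \<one>\<^bsub>G\<^esub> \<in> set xs then 0 else frag_of xs)"

definition bar_chains :: "nat \<Rightarrow> ('a, 'b) monoid_scheme \<Rightarrow> ('a list \<Rightarrow>\<^sub>0 int) monoid" where
  "bar_chains k G = free_Abelian_group {xs. length xs = k \<and> set xs \<subseteq> carrier G - {\<one>\<^bsub>G\<^esub>}}"

text \<open>\<open>merge G i [x\<^sub>1,\<dots>,x\<^sub>k] = [x\<^sub>1,\<dots>,x\<^sub>i x\<^sub>i\<^sub>+\<^sub>1,\<dots>,x\<^sub>k]\<close> for \<open>1 \<le> i < k\<close>; list positions
  count from 0, so that \<open>x\<^sub>i\<close> is \<open>xs ! (i - 1)\<close>.\<close>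

definition merge :: "('a, 'b) monoid_scheme \<Rightarrow> nat \<Rightarrow> 'a list \<Rightarrow> 'a list" where
  "merge G i xs = take (i - 1) xs @ [xs ! (i - 1) \<otimes>\<^bsub>G\<^esub> xs ! i] @ drop (Suc i) xs"

definition bar_face_sum :: "('a, 'b) monoid_scheme \<Rightarrow> 'a list \<Rightarrow> ('a list \<Rightarrow>\<^sub>0 int)" where
  "bar_face_sum G xs =
     (if xs = [] then 0
      else bar G (tl xs)
           + (\<Sum>i = 1..<length xs. frag_cmul ((-1) ^ i) (bar G (merge G i xs)))
           + frag_cmul ((-1) ^ length xs) (bar G (butlast xs)))"

definition bar_boundary :: "('a, 'b) monoid_scheme \<Rightarrow> ('a list \<Rightarrow>\<^sub>0 int) \<Rightarrow> ('a list \<Rightarrow>\<^sub>0 int)" where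
  "bar_boundary G = frag_extend (bar_face_sum G)"

definition bar_cycles :: "nat \<Rightarrow> ('a, 'b) monoid_scheme \<Rightarrow> ('a list \<Rightarrow>\<^sub>0 int) set" where
  "bar_cycles k G = {c \<in> carrier (bar_chains k G). bar_boundary G c = 0}"

definition bar_boundaries :: "nat \<Rightarrow> ('a, 'b) monoid_scheme \<Rightarrow> ('a list \<Rightarrow>\<^sub>0 int) set" where
  "bar_boundaries k G = bar_boundary G ` carrier (bar_chains (Suc k) G)"

definition group_homology ::
    "nat \<Rightarrow> ('a, 'b) monoid_scheme \<Rightarrow> ('a list \<Rightarrow>\<^sub>0 int) set monoid" where
  "group_homology k G = subgroup_generated (bar_chains k G) (bar_cycles k G) Mod bar_boundaries k G"

definition homology_class ::
    "nat \<Rightarrow> ('a, 'b) monoid_scheme \<Rightarrow> ('a list \<Rightarrow>\<^sub>0 int) \<Rightarrow> ('a list \<Rightarrow>\<^sub>0 int) set" where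
  "homology_class k G c = bar_boundaries k G #>\<^bsub>bar_chains k G\<^esub> c"

text \<open>Maps on homology given by chain-level formulas are defined as the union of the image
  classes over all representatives; by well-definedness this is a single class.\<close>

definition bar_map ::
    "('c, 'd) monoid_scheme \<Rightarrow> ('a \<Rightarrow> 'c) \<Rightarrow> ('a list \<Rightarrow>\<^sub>0 int) \<Rightarrow> ('c list \<Rightarrow>\<^sub>0 int)" where
  "bar_map H f = frag_extend (\<lambda>xs. bar H (map f xs))"

definition homology_map ::
    "nat \<Rightarrow> ('c, 'd) monoid_scheme \<Rightarrow> ('a \<Rightarrow> 'c) \<Rightarrow> ('a list \<Rightarrow>\<^sub>0 int) set \<Rightarrow> ('c list \<Rightarrow>\<^sub>0 int) set"
  where
  "homology_map k H f C = (\<Union>c\<in>C. homology_class k H (bar_map H f c))"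


section \<open>Pontryagin products\<close>

text \<open>For abelian \<open>A\<close>, the Pontryagin product on \<open>H\<^sub>*(A)\<close> is induced by the shuffle product
  of the bar complex: the signed sum of all shuffles of two lists, where moving a letter of the
  second list past \<open>p\<close> letters of the first contributes the sign \<open>(-1)\<^sup>p\<close>.
  In particular \<open>[x] * [y] = [x|y] - [y|x]\<close>.\<close>

fun list_shuffle :: "'a list \<Rightarrow> 'a list \<Rightarrow> ('a list \<Rightarrow>\<^sub>0 int)" where
  "list_shuffle [] ys = frag_of ys"
| "list_shuffle xs [] = frag_of xs"
| "list_shuffle (x # xs) (y # ys) =
     frag_extend (\<lambda>zs. frag_of (x # zs)) (list_shuffle xs (y # ys))
     + frag_cmul ((-1) ^ length (x # xs))
         (frag_extend (\<lambda>zs. frag_of (y # zs)) (list_shuffle (x # xs) ys))"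

definition bar_shuffle :: "('a list \<Rightarrow>\<^sub>0 int) \<Rightarrow> ('a list \<Rightarrow>\<^sub>0 int) \<Rightarrow> ('a list \<Rightarrow>\<^sub>0 int)" where
  "bar_shuffle c d = frag_extend (\<lambda>xs. frag_extend (\<lambda>ys. list_shuffle xs ys) d) c"

definition pontryagin_product ::
    "nat \<Rightarrow> nat \<Rightarrow> ('a, 'b) monoid_scheme \<Rightarrow> ('a list \<Rightarrow>\<^sub>0 int) set \<Rightarrow> ('a list \<Rightarrow>\<^sub>0 int) set
      \<Rightarrow> ('a list \<Rightarrow>\<^sub>0 int) set" where
  "pontryagin_product p q A C D =
     (\<Union>c\<in>C. \<Union>d\<in>D. homology_class (p + q) A (bar_shuffle c d))"

text \<open>The class \<open>\<langle>g,h\<rangle> \<in> H\<^sub>2(G)\<close> of commuting elements. An element \<open>a\<close> of the abelian group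
  \<open>\<int> \<times> \<int>\<close> is regarded as the class of \<open>[a]\<close> in \<open>H\<^sub>1(\<int> \<times> \<int>)\<close>, and \<open>(a, b) \<mapsto> g\<^sup>a h\<^sup>b\<close> is the
  homomorphism with \<open>(1,0) \<mapsto> g\<close> and \<open>(0,1) \<mapsto> h\<close>.\<close>

definition pontryagin :: "('a, 'b) monoid_scheme \<Rightarrow> 'a \<Rightarrow> 'a \<Rightarrow> ('a list \<Rightarrow>\<^sub>0 int) set" where
  "pontryagin G g h =
     (let ZZ = integer_group \<times>\<times> integer_group;
          \<phi> = (\<lambda>(a, b). g [^]\<^bsub>G\<^esub> (a::int) \<otimes>\<^bsub>G\<^esub> h [^]\<^bsub>G\<^esub> (b::int))
      in homology_map 2 G \<phi>
           (pontryagin_product 1 1 ZZ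
              (homology_class 1 ZZ (bar ZZ [(1, 0)]))
              (homology_class 1 ZZ (bar ZZ [(0, 1)]))))"


section \<open>The Hopf isomorphism\<close>

definition hopf_group :: "('a, 'b) monoid_scheme \<Rightarrow> 'a set \<Rightarrow> 'a set monoid" where
  "hopf_group F R =
     subgroup_generated F (R \<inter> derived F (carrier F)) Mod commutator_subgroup F (carrier F) R"

definition hopf_class :: "('a, 'b) monoid_scheme \<Rightarrow> 'a set \<Rightarrow> 'a \<Rightarrow> 'a set" where
  "hopf_class F R r = commutator_subgroup F (carrier F) R #>\<^bsub>F\<^esub> r"

definition comm_prod :: "('a, 'b) monoid_scheme \<Rightarrow> ('a \<times> 'a) list \<Rightarrow> 'a" where
  "comm_prod G ps = foldr (\<lambda>(x, y) z. commutator G x y \<otimes>\<^bsub>G\<^esub> z) ps \<one>\<^bsub>G\<^esub>"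

text \<open>The bar chain of a list of pairs \<open>(g\<^sub>1,h\<^sub>1),\<dots>,(g\<^sub>m,h\<^sub>m)\<close>; with positions counted from 0,
  \<open>I k\<close> is the product of the first \<open>k\<close> commutators.\<close>

definition hopf_chain :: "('a, 'b) monoid_scheme \<Rightarrow> ('a \<times> 'a) list \<Rightarrow> ('a list \<Rightarrow>\<^sub>0 int)" where
  "hopf_chain G ps =
     (\<Sum>k<length ps.
        let g = fst (ps ! k); h = snd (ps ! k); I = (\<lambda>k. comm_prod G (take k ps))
        in bar G [I k, g]
           + bar G [I k \<otimes>\<^bsub>G\<^esub> g, h]
           - bar G [I k \<otimes>\<^bsub>G\<^esub> g \<otimes>\<^bsub>G\<^esub> h \<otimes>\<^bsub>G\<^esub> inv\<^bsub>G\<^esub> g, g]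
           - bar G [I (Suc k), h])"

text \<open>The Hopf isomorphism \<open>(R \<inter> [F,F]) / [F,R] \<rightarrow> H\<^sub>2(F/R)\<close> for a free group \<open>F\<close> and a normal
  subgroup \<open>R\<close>: the image of a class is computed from any representative written as a product of
  commutators.\<close>

definition hopf_map ::
    "('a, 'b) monoid_scheme \<Rightarrow> 'a set \<Rightarrow> 'a set \<Rightarrow> ('a set list \<Rightarrow>\<^sub>0 int) set" where
  "hopf_map F R C =
     (THE c. \<exists>ps. set ps \<subseteq> carrier F \<times> carrier F \<and> comm_prod F ps \<in> C \<and>
        c = homology_class 2 (F Mod R)
              (hopf_chain (F Mod R) (map (\<lambda>(x, y). (R #>\<^bsub>F\<^esub> x, R #>\<^bsub>F\<^esub> y)) ps)))"


section \<open>Even Coxeter groups\<close>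

text \<open>Matrices over \<open>{1..n}\<close> are functions of two indices, of which only the values with both
  indices in \<open>{1..n}\<close> matter.\<close>

definition coxeter_matrix :: "nat \<Rightarrow> (nat \<Rightarrow> nat \<Rightarrow> enat) \<Rightarrow> bool" where
  "coxeter_matrix n M \<longleftrightarrow>
     (\<forall>i\<in>{1..n}. M i i = 1) \<and>
     (\<forall>i\<in>{1..n}. \<forall>j\<in>{1..n}. i \<noteq> j \<longrightarrow> M i j = M j i \<and> 2 \<le> M i j)"

definition even_coxeter_matrix :: "nat \<Rightarrow> (nat \<Rightarrow> nat \<Rightarrow> enat) \<Rightarrow> bool" where
  "even_coxeter_matrix n M \<longleftrightarrow>
     coxeter_matrix n M \<and>
     (\<forall>i\<in>{1..n}. \<forall>j\<in>{1..n}. i \<noteq> j \<longrightarrow> M i j = \<infinity> \<or> (\<exists>m. even m \<and> M i j = enat m))"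

definition finite_pairs :: "nat \<Rightarrow> (nat \<Rightarrow> nat \<Rightarrow> enat) \<Rightarrow> (nat \<times> nat) set" where
  "finite_pairs n M = {(i, j). 1 \<le> i \<and> i < j \<and> j \<le> n \<and> M i j < \<infinity>}"

text \<open>\<open>n(i,j) = m(i,j) / 2\<close>, used only where \<open>m(i,j)\<close> is finite.\<close>

definition half_exp :: "(nat \<Rightarrow> nat \<Rightarrow> enat) \<Rightarrow> nat \<Rightarrow> nat \<Rightarrow> nat" where
  "half_exp M i j = the_enat (M i j) div 2"

definition coxeter_free :: "nat \<Rightarrow> (bool \<times> nat) list monoid" where
  "coxeter_free n = free_group {1..n}"

definition even_coxeter_relators :: "nat \<Rightarrow> (nat \<Rightarrow> nat \<Rightarrow> enat) \<Rightarrow> (bool \<times> nat) list set" where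
  "even_coxeter_relators n M =
     (let F = coxeter_free n in
      {gen i [^]\<^bsub>F\<^esub> (2::nat) | i. i \<in> {1..n}} \<union>
      {(gen i \<otimes>\<^bsub>F\<^esub> gen j) [^]\<^bsub>F\<^esub> half_exp M i j
         \<otimes>\<^bsub>F\<^esub> inv\<^bsub>F\<^esub> ((gen j \<otimes>\<^bsub>F\<^esub> gen i) [^]\<^bsub>F\<^esub> half_exp M i j) | i j. (i, j) \<in> finite_pairs n M})"

definition even_coxeter_rel :: "nat \<Rightarrow> (nat \<Rightarrow> nat \<Rightarrow> enat) \<Rightarrow> (bool \<times> nat) list set" where
  "even_coxeter_rel n M = normal_closure (coxeter_free n) (even_coxeter_relators n M)"

definition even_coxeter_group :: "nat \<Rightarrow> (nat \<Rightarrow> nat \<Rightarrow> enat) \<Rightarrow> (bool \<times> nat) list set monoid" where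
  "even_coxeter_group n M = coxeter_free n Mod even_coxeter_rel n M"

definition coxeter_gen :: "nat \<Rightarrow> (nat \<Rightarrow> nat \<Rightarrow> enat) \<Rightarrow> nat \<Rightarrow> (bool \<times> nat) list set" where
  "coxeter_gen n M i = even_coxeter_rel n M #>\<^bsub>coxeter_free n\<^esub> gen i"

end

theory Submission
  imports Defs
begin

text \<open>Modulo boundaries, \<open>(g, h) \<mapsto> [g|h]\<close> is a 2-cocycle on \<open>G = F/R\<close> with trivial coefficients, so
  it defines a central extension of \<open>G\<close>. As \<open>F\<close> is free, the projection \<open>F \<rightarrow> G\<close> lifts to this
  extension; the central component of the lift is a function \<open>\<sigma>\<close> on \<open>F\<close> with
  \<open>\<sigma>(u v) = \<sigma>(u) + \<sigma>(v) + [u|v]\<close> modulo boundaries. It vanishes on \<open>[F,R]\<close> and sends a product of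
  commutators to its Hopf chain, so the Hopf map may be computed from any representative.

  Put \<open>a = s\<^sub>i\<close>, \<open>b = s\<^sub>j\<close>, \<open>m = n(i,j)\<close> and \<open>c = (b a)\<^sub>2\<^sub>m\<^sub>-\<^sub>1\<close> in \<open>F\<close>. Then
  \<open>[a, c] = (a b)\<^sup>m (b a)\<^sup>-\<^sup>m\<close> is a relator. Modulo \<open>[F,R]\<close> the squares \<open>a\<^sup>2\<close> and \<open>b\<^sup>2\<close> are central, hence
  \<open>a b\<close> and \<open>b a\<close> commute and \<open>[a, c] = [a, b]\<^sup>m\<close>. The Hopf chain of the single commutator \<open>[a, c]\<close>
  is \<open>[a|c] - [c|a]\<close>, which represents the Pontryagin product.\<close>

section \<open>Free groups\<close>

lemma inv_letter_inv_letter [simp]: "inv_letter (inv_letter l) = l"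
  by (simp add: inv_letter_def)

lemma snd_inv_letter [simp]: "snd (inv_letter l) = snd l"
  by (simp add: inv_letter_def)

lemma fst_inv_letter [simp]: "fst (inv_letter l) = (\<not> fst l)"
  by (simp add: inv_letter_def)

lemma reduced_Nil [simp]: "reduced []"
  by (simp add: reduced_def)

lemma reduced_Cons: "reduced (l # w) \<longleftrightarrow> (w = [] \<or> hd w \<noteq> inv_letter l) \<and> reduced w"
proof (cases w)
  case (Cons k w')
  then show ?thesis
    unfolding reduced_def by (auto simp: less_Suc_eq_0_disj)
qed (simp add: reduced_def)

lemma push_letter_reduced: "reduced (l # w) \<Longrightarrow> push_letter l w = l # w"
  by (cases w) (auto simp: reduced_Cons)

lemma reduced_push_letter: "reduced w \<Longrightarrow> reduced (push_letter l w)"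
  by (cases w) (auto simp: reduced_Cons)

lemma set_push_letter: "set (push_letter l w) \<subseteq> insert l (set w)"
  by (cases w) auto

lemma push_letter_inv_letter: "reduced w \<Longrightarrow> push_letter l (push_letter (inv_letter l) w) = w"
  by (cases w) (auto simp: reduced_Cons push_letter_reduced)

lemma reduced_foldr_push_letter: "reduced v \<Longrightarrow> reduced (foldr push_letter u v)"
  by (induction u) (auto intro: reduced_push_letter)

lemma set_foldr_push_letter: "set (foldr push_letter u v) \<subseteq> set u \<union> set v"
  by (induction u) (use set_push_letter in fastforce)+

text \<open>Van der Waerden's argument: on reduced words, pushing a letter and pushing its inverse
  undo each other. A word therefore acts on reduced words through its reduced form, and
  associativity becomes composition of pushes.\<close>

lemma foldr_push_letter_push_letter:
  assumes "reduced w"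
  shows "foldr push_letter (push_letter l v) w = push_letter l (foldr push_letter v w)"
  using assms
  by (cases v) (auto simp: push_letter_inv_letter reduced_foldr_push_letter)

lemma foldr_push_letter_assoc:
  assumes "reduced w"
  shows "foldr push_letter (foldr push_letter u v) w = foldr push_letter u (foldr push_letter v w)"
  using assms by (induction u) (auto simp: foldr_push_letter_push_letter)

lemma foldr_push_letter_inverse: "foldr push_letter (rev (map inv_letter u)) u = []"
  by (induction u) auto

lemma group_free_group: "group (free_group S)"
proof (rule groupI)
  fix u assume u: "u \<in> carrier (free_group S)"
  \<comment> \<open>For reduced \<open>u\<close> the reversed word of inverse letters is already
    reduced. Pushing it onto the empty word gives a reduced word without having to show
    this.\<close>
  define v where "v = foldr push_letter (rev (map inv_letter u)) []"
  have "set v \<subseteq> inv_letter ` set u"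
    using set_foldr_push_letter[of "rev (map inv_letter u)" "[]"] by (simp add: v_def)
  then have "snd ` set v \<subseteq> snd ` set u"
    by (force simp: inv_letter_def dest!: subsetD)
  then have "v \<in> carrier (free_group S)"
    using u by (auto simp: free_group_def v_def reduced_foldr_push_letter)
  moreover have "v \<otimes>\<^bsub>free_group S\<^esub> u = \<one>\<^bsub>free_group S\<^esub>"
    using u by (simp add: free_group_def v_def foldr_push_letter_assoc foldr_push_letter_inverse)
  ultimately show "\<exists>v\<in>carrier (free_group S). v \<otimes>\<^bsub>free_group S\<^esub> u = \<one>\<^bsub>free_group S\<^esub>"
    by blast
next
  fix u v assume "u \<in> carrier (free_group S)" "v \<in> carrier (free_group S)"
  then show "u \<otimes>\<^bsub>free_group S\<^esub> v \<in> carrier (free_group S)"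
    using set_foldr_push_letter[of u v]
    by (fastforce simp: free_group_def reduced_foldr_push_letter)
qed (auto simp: free_group_def foldr_push_letter_assoc)

lemma gen_in_free_group: "x \<in> S \<Longrightarrow> gen x \<in> carrier (free_group S)"
  by (simp add: free_group_def gen_def reduced_Cons)

text \<open>In a reduced word no cancellation occurs at the head, so list induction serves as
  induction on products of letters in the group.\<close>

lemma free_group_Cons:
  assumes "l # w \<in> carrier (free_group S)"
  shows "[l] \<in> carrier (free_group S)" "w \<in> carrier (free_group S)"
    and "l # w = [l] \<otimes>\<^bsub>free_group S\<^esub> w"
  using assms by (auto simp: free_group_def reduced_Cons push_letter_reduced)

section \<open>Bar chains and Pontryagin products\<close>

lemma bar_boundary_diff: "bar_boundary G (c - d) = bar_boundary G c - bar_boundary G d"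
  by (simp add: bar_boundary_def frag_extend_diff)

lemma bar_boundaries_0 [simp]: "0 \<in> bar_boundaries k G"
  unfolding bar_boundaries_def bar_boundary_def bar_chains_def
  by (rule image_eqI[where x = 0]) auto

lemma bar_chains_diff:
  "c \<in> carrier (bar_chains k G) \<Longrightarrow> d \<in> carrier (bar_chains k G) \<Longrightarrow>
   c - d \<in> carrier (bar_chains k G)"
  unfolding bar_chains_def carrier_free_Abelian_group_iff
  by (meson keys_diff Un_least order_trans)

lemma bar_boundaries_diff:
  assumes "c \<in> bar_boundaries k G" "d \<in> bar_boundaries k G"
  shows "c - d \<in> bar_boundaries k G"
proof -
  obtain c' d' where "c = bar_boundary G c'" "d = bar_boundary G d'"
    "c' \<in> carrier (bar_chains (Suc k) G)" "d' \<in> carrier (bar_chains (Suc k) G)"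
    using assms by (auto simp: bar_boundaries_def)
  then show ?thesis
    by (metis bar_boundaries_def bar_boundary_diff bar_chains_diff image_eqI)
qed

lemma bar_boundaries_uminus: "c \<in> bar_boundaries k G \<Longrightarrow> - c \<in> bar_boundaries k G"
  using bar_boundaries_diff[OF bar_boundaries_0, of c k G] by simp

lemma bar_boundaries_add:
  assumes "c \<in> bar_boundaries k G" "d \<in> bar_boundaries k G"
  shows "c + d \<in> bar_boundaries k G"
  using bar_boundaries_diff[OF assms(1) bar_boundaries_uminus[OF assms(2)]] by simp

lemma bar_chains_induct [consumes 1, case_names zero one diff]:
  assumes "c \<in> carrier (bar_chains k G)" and "P 0"
    and "\<And>xs. length xs = k \<Longrightarrow> set xs \<subseteq> carrier G - {\<one>\<^bsub>G\<^esub>} \<Longrightarrow> P (frag_of xs)"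
    and "\<And>a b. P a \<Longrightarrow> P b \<Longrightarrow> P (a - b)"
  shows "P c"
proof -
  have "Poly_Mapping.keys c \<subseteq> {xs. length xs = k \<and> set xs \<subseteq> carrier G - {\<one>\<^bsub>G\<^esub>}}"
    using assms(1) by (simp add: bar_chains_def)
  then show ?thesis
    by (rule frag_induction) (use assms in auto)
qed

text \<open>The boundary map is additive, so the face sums of nondegenerate symbols generate all
  boundaries under differences.\<close>

lemma bar_boundaries_induct [consumes 1, case_names zero face diff]:
  assumes "c \<in> bar_boundaries k G" and "P 0"
    and "\<And>xs. length xs = Suc k \<Longrightarrow> set xs \<subseteq> carrier G - {\<one>\<^bsub>G\<^esub>} \<Longrightarrow> P (bar_face_sum G xs)"
    and "\<And>a b. P a \<Longrightarrow> P b \<Longrightarrow> P (a - b)"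
  shows "P c"
proof -
  obtain e where e: "e \<in> carrier (bar_chains (Suc k) G)" "c = bar_boundary G e"
    using assms(1) by (auto simp: bar_boundaries_def)
  from e(1) have "P (bar_boundary G e)"
    by (induction rule: bar_chains_induct)
       (use assms in \<open>auto simp: bar_boundary_def frag_extend_diff\<close>)
  then show ?thesis by (simp add: e)
qed

section \<open>Homology classes as cosets, and the cocycle relation\<close>

lemma homology_class_eq: "homology_class k G c = (\<lambda>b. b + c) ` bar_boundaries k G"
  by (auto simp: homology_class_def r_coset_def bar_chains_def)

lemma homology_class_self: "c \<in> homology_class k G c"
  using image_eqI[of c "\<lambda>b. b + c" 0] by (simp add: homology_class_eq)

lemma in_homology_class_iff: "d \<in> homology_class k G c \<longleftrightarrow> d - c \<in> bar_boundaries k G"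
  using image_eqI[of d "\<lambda>b. b + c" "d - c"] by (auto simp: homology_class_eq)

lemma homology_class_cong:
  assumes "c - d \<in> bar_boundaries k G"
  shows "homology_class k G c = homology_class k G d"
proof -
  have "e - c \<in> bar_boundaries k G \<longleftrightarrow> e - d \<in> bar_boundaries k G" for e
    using bar_boundaries_diff[OF _ assms, of "e - d"] bar_boundaries_add[OF _ assms, of "e - c"]
    by auto
  then show ?thesis
    by (auto simp: in_homology_class_iff)
qed

lemma bar_one [simp]: "bar G [\<one>\<^bsub>G\<^esub>] = 0" "bar G [\<one>\<^bsub>G\<^esub>, x] = 0" "bar G [x, \<one>\<^bsub>G\<^esub>] = 0"
  by (simp_all add: bar_def)

lemma bar_face_sum_2: "bar_face_sum G [a, b] = bar G [b] - bar G [a \<otimes>\<^bsub>G\<^esub> b] + bar G [a]"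
  by (simp add: bar_face_sum_def merge_def)

lemma bar_face_sum_3:
  "bar_face_sum G [a, b, c] =
     bar G [b, c] - bar G [a \<otimes>\<^bsub>G\<^esub> b, c] + bar G [a, b \<otimes>\<^bsub>G\<^esub> c] - bar G [a, b]"
  by (simp add: bar_face_sum_def merge_def sum.atLeastLessThan_Suc)

text \<open>A symbol with an identity entry is not a normalized chain, but its four faces vanish or
  cancel in pairs. The cocycle relation thus holds for arbitrary triples, and later arguments need
  no check for degeneracy.\<close>

lemma (in group) bar_face_sum_3_boundary:
  assumes "a \<in> carrier G" "b \<in> carrier G" "c \<in> carrier G"
  shows "bar_face_sum G [a, b, c] \<in> bar_boundaries 2 G"
proof (cases "\<one> \<in> {a, b, c}")
  case True
  then consider "a = \<one>" | "b = \<one>" | "c = \<one>" by blast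
  then have "bar_face_sum G [a, b, c] = 0"
    by cases (use assms in \<open>simp_all add: bar_face_sum_3\<close>)
  then show ?thesis by simp
next
  case False
  then have "frag_of [a, b, c] \<in> carrier (bar_chains (Suc 2) G)"
    using assms by (auto simp: bar_chains_def)
  then have "bar_boundary G (frag_of [a, b, c]) \<in> bar_boundaries 2 G"
    unfolding bar_boundaries_def by (rule imageI)
  then show ?thesis
    by (simp add: bar_boundary_def)
qed

lemma bar_map_diff: "bar_map H f (c - d) = bar_map H f c - bar_map H f d"
  by (simp add: bar_map_def frag_extend_diff)

lemma bar_map_add: "bar_map H f (c + d) = bar_map H f c + bar_map H f d"
  by (simp add: bar_map_def frag_extend_add)

lemma (in group_hom) bar_map_bar: "bar_map H h (bar G xs) = bar H (map h xs)"
proof (cases "\<one>\<^bsub>G\<^esub> \<in> set xs")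
  case True
  then have "\<one>\<^bsub>H\<^esub> \<in> h ` set xs"
    by (metis hom_one image_eqI)
  with True show ?thesis
    by (simp add: bar_map_def bar_def)
qed (simp add: bar_map_def bar_def)

text \<open>A homomorphism carries faces to faces. It may make a symbol degenerate, which
  \<open>bar_face_sum_3_boundary\<close> allows for.\<close>

lemma (in group_hom) bar_map_boundaries:
  assumes "c \<in> bar_boundaries 2 G"
  shows "bar_map H h c \<in> bar_boundaries 2 H"
  using assms
proof (induction rule: bar_boundaries_induct)
  case (face xs)
  then obtain x y z where xs: "xs = [x, y, z]" and *: "x \<in> carrier G" "y \<in> carrier G" "z \<in> carrier G"
    by (auto simp: length_Suc_conv numeral_2_eq_2)
  have "bar_map H h (bar_face_sum G xs) = bar_face_sum H [h x, h y, h z]"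
    using * by (simp add: xs bar_face_sum_3 bar_map_add bar_map_diff bar_map_bar)
  then show ?case
    using * H.bar_face_sum_3_boundary by simp
qed (auto simp: bar_map_diff bar_boundaries_diff, simp add: bar_map_def)

text \<open>The union defining \<open>homology_map\<close> runs over a nonempty family of equal
  classes: representatives differ by boundaries, and these map to boundaries.\<close>

lemma (in group_hom) homology_map_class:
  "homology_map 2 H h (homology_class 2 G c) = homology_class 2 H (bar_map H h c)"
proof -
  have "homology_class 2 H (bar_map H h d) = homology_class 2 H (bar_map H h c)"
    if "d \<in> homology_class 2 G c" for d
    using that bar_map_boundaries[of "d - c"]
    by (intro homology_class_cong) (simp add: in_homology_class_iff bar_map_diff)
  then have "homology_map 2 H h (homology_class 2 G c) =
      (\<Union>d\<in>homology_class 2 G c. homology_class 2 H (bar_map H h c))"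
    unfolding homology_map_def by (intro SUP_cong refl)
  then show ?thesis
    using homology_class_self[of c 2 G] by auto
qed

section \<open>Shuffle products of one-dimensional classes\<close>

lemma bar_shuffle_diff_left: "bar_shuffle (c - c') d = bar_shuffle c d - bar_shuffle c' d"
  by (simp add: bar_shuffle_def frag_extend_diff)

lemma bar_shuffle_diff_right: "bar_shuffle c (d - d') = bar_shuffle c d - bar_shuffle c d'"
  by (induction c rule: frag_induction[OF subset_UNIV])
     (simp_all add: bar_shuffle_def frag_extend_diff)

lemma bar_shuffle_add_left: "bar_shuffle (c + c') d = bar_shuffle c d + bar_shuffle c' d"
  by (simp add: bar_shuffle_def frag_extend_add)

lemma bar_shuffle_add_right: "bar_shuffle c (d + d') = bar_shuffle c d + bar_shuffle c d'"
  using bar_shuffle_diff_right[of c "d + d'" d'] by (simp add: algebra_simps)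

lemma bar_shuffle_0 [simp]: "bar_shuffle 0 d = 0" "bar_shuffle c 0 = 0"
  using bar_shuffle_diff_left[of 0 0] bar_shuffle_diff_right[of c 0 0] by auto

lemma bar_shuffle_bar_1: "bar_shuffle (bar G [x]) (bar G [y]) = bar G [x, y] - bar G [y, x]"
  by (simp add: bar_def bar_shuffle_def)

text \<open>The Leibniz rule in low degree. With trivial coefficients every 1-chain is a cycle, so a
  boundary times \<open>d\<close> is up to sign the boundary of a shuffle product.\<close>

lemma (in comm_group) bar_shuffle_boundary:
  assumes "b \<in> bar_boundaries 1 G" "d \<in> carrier (bar_chains 1 G)"
  shows "bar_shuffle b d \<in> bar_boundaries 2 G \<and> bar_shuffle d b \<in> bar_boundaries 2 G"
  using assms
proof (induction rule: bar_boundaries_induct)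
  case (face xs)
  then obtain x y where xs: "xs = [x, y]" and xy: "x \<in> carrier G" "y \<in> carrier G"
    by (auto simp: length_Suc_conv)
  from face(3) show ?case
  proof (induction rule: bar_chains_induct)
    case (one zs)
    then obtain z where z: "zs = [z]" "z \<in> carrier G" "z \<noteq> \<one>"
      by (auto simp: length_Suc_conv)
    then have fz: "frag_of zs = bar G [z]"
      by (simp add: bar_def)
    \<comment> \<open>The signed face sums of the three shuffles of \<open>[x, y]\<close> with
      \<open>[z]\<close>. The faces merging \<open>z\<close> with \<open>x\<close> or
      \<open>y\<close> cancel because \<open>z\<close> commutes with both.\<close>
    let ?e = "bar_face_sum G [x, y, z] - bar_face_sum G [x, z, y] + bar_face_sum G [z, x, y]"
    have e: "?e \<in> bar_boundaries 2 G"
      using xy z by (intro bar_boundaries_add bar_boundaries_diff bar_face_sum_3_boundary)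
    have "bar_shuffle (bar_face_sum G xs) (frag_of zs) = ?e"
         "bar_shuffle (frag_of zs) (bar_face_sum G xs) = - ?e"
      using xy z m_comm[of z x] m_comm[of z y]
      by (simp_all add: xs fz[unfolded z] z(1) bar_face_sum_2 bar_face_sum_3 bar_shuffle_add_left bar_shuffle_diff_left
          bar_shuffle_add_right bar_shuffle_diff_right bar_shuffle_bar_1)
    then show ?case
      using e bar_boundaries_uminus by metis
  qed (auto simp: bar_shuffle_diff_left bar_shuffle_diff_right bar_boundaries_diff)
qed (auto simp: bar_shuffle_diff_left bar_shuffle_diff_right bar_boundaries_diff)

lemma bar_in_bar_chains: "length xs = k \<Longrightarrow> set xs \<subseteq> carrier G \<Longrightarrow> bar G xs \<in> carrier (bar_chains k G)"
  by (auto simp: bar_def bar_chains_def)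

lemma bar_chains_add:
  "c \<in> carrier (bar_chains k G) \<Longrightarrow> d \<in> carrier (bar_chains k G) \<Longrightarrow>
   c + d \<in> carrier (bar_chains k G)"
  unfolding bar_chains_def carrier_free_Abelian_group_iff
  by (meson keys_add Un_least order_trans)

lemma (in group) bar_boundaries_1_subset: "bar_boundaries 1 G \<subseteq> carrier (bar_chains 1 G)"
proof
  fix b assume "b \<in> bar_boundaries 1 G"
  then show "b \<in> carrier (bar_chains 1 G)"
  proof (induction rule: bar_boundaries_induct)
    case zero
    show ?case by (simp add: bar_chains_def)
  next
    case (face xs)
    then obtain x y where "xs = [x, y]" "x \<in> carrier G" "y \<in> carrier G"
      by (auto simp: length_Suc_conv)
    then show ?case
      by (auto simp: bar_face_sum_2 intro!: bar_chains_add bar_chains_diff bar_in_bar_chains)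
  qed (rule bar_chains_diff)
qed

lemma (in comm_group) pontryagin_product_1_1:
  assumes "x \<in> carrier G" "y \<in> carrier G"
  shows "pontryagin_product 1 1 G (homology_class 1 G (bar G [x])) (homology_class 1 G (bar G [y])) =
    homology_class 2 G (bar G [x, y] - bar G [y, x])"
proof -
  have "homology_class 2 G (bar_shuffle c d) = homology_class 2 G (bar G [x, y] - bar G [y, x])"
    if "c \<in> homology_class 1 G (bar G [x])" "d \<in> homology_class 1 G (bar G [y])" for c d
  proof (rule homology_class_cong)
    define b b' where "b = c - bar G [x]" and "b' = d - bar G [y]"
    have b: "b \<in> bar_boundaries 1 G" "b' \<in> bar_boundaries 1 G"
      using that by (simp_all add: b_def b'_def in_homology_class_iff)
    have xy: "bar G [x] \<in> carrier (bar_chains 1 G)" "bar G [y] \<in> carrier (bar_chains 1 G)"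
      using assms by (auto intro: bar_in_bar_chains)
    then have "b' + bar G [y] \<in> carrier (bar_chains 1 G)"
      using b bar_boundaries_1_subset by (blast intro: bar_chains_add)
    \<comment> \<open>By bilinearity, replacing \<open>[x]\<close> by \<open>c = b + [x]\<close> and
      \<open>[y]\<close> by \<open>d = b' + [y]\<close> changes the product by exactly this
      sum.\<close>
    then have "bar_shuffle b d + bar_shuffle (bar G [x]) b' \<in> bar_boundaries 2 G"
      using b xy bar_shuffle_boundary by (auto simp: b'_def intro!: bar_boundaries_add)
    then show "bar_shuffle c d - (bar G [x, y] - bar G [y, x]) \<in> bar_boundaries 2 G"
      by (simp add: b_def b'_def bar_shuffle_diff_left bar_shuffle_diff_right bar_shuffle_bar_1
          algebra_simps)
  qed
  then have "pontryagin_product 1 1 G (homology_class 1 G (bar G [x])) (homology_class 1 G (bar G [y])) =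
      (\<Union>c\<in>homology_class 1 G (bar G [x]). \<Union>d\<in>homology_class 1 G (bar G [y]).
        homology_class 2 G (bar G [x, y] - bar G [y, x]))"
    unfolding pontryagin_product_def one_add_one by (intro SUP_cong refl)
  then show ?thesis
    using homology_class_self[of "bar G [x]" 1 G] homology_class_self[of "bar G [y]" 1 G] by auto
qed

lemma (in group) int_pow_commute:
  assumes "x \<in> carrier G" "y \<in> carrier G" "x \<otimes> y = y \<otimes> x"
  shows "x \<otimes> y [^] (n::int) = y [^] n \<otimes> x"
proof -
  have nat: "x \<otimes> z [^] m = z [^] m \<otimes> x" if "z \<in> carrier G" "x \<otimes> z = z \<otimes> x" for z and m :: nat
    using that assms by (metis group_commutes_pow)
  have "x \<otimes> inv y = inv y \<otimes> x"
    using assms by (metis inv_closed inv_solve_left inv_solve_right m_assoc m_closed)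
  then show ?thesis
    using assms by (cases n rule: int_cases2) (auto simp: nat int_pow_neg_int int_pow_int simp flip: nat_pow_inv)
qed

text \<open>Since \<open>g\<close> and \<open>h\<close> commute, the exponent map from pairs of
  integers is a homomorphism. Naturality then transports the shuffle cycle of \<open>(1, 0)\<close>
  and \<open>(0, 1)\<close>.\<close>

lemma (in group) pontryagin_eq:
  assumes gh: "g \<in> carrier G" "h \<in> carrier G" and comm: "g \<otimes> h = h \<otimes> g"
  shows "pontryagin G g h = homology_class 2 G (bar G [g, h] - bar G [h, g])"
proof -
  let ?Z = "integer_group \<times>\<times> integer_group"
  let ?\<phi> = "\<lambda>(a, b). g [^] (a::int) \<otimes> h [^] (b::int)"
  have pow_comm: "h [^] b \<otimes> g [^] a = g [^] a \<otimes> h [^] b" for a b :: int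
    using gh comm by (intro int_pow_commute int_pow_closed) (auto simp: int_pow_commute)
  interpret Z: comm_group ?Z
    by (rule group.group_comm_groupI) (auto simp: DirProd_group)
  have "?\<phi> \<in> hom ?Z G"
  proof (rule homI)
    fix x y assume "x \<in> carrier ?Z" "y \<in> carrier ?Z"
    obtain a b a' b' where [simp]: "x = (a, b)" "y = (a', b')" by (cases x, cases y)
    have "h [^] b \<otimes> (g [^] a' \<otimes> h [^] b') = g [^] a' \<otimes> (h [^] b \<otimes> h [^] b')"
      using gh pow_comm[of b a'] by (simp flip: m_assoc)
    then show "?\<phi> (x \<otimes>\<^bsub>?Z\<^esub> y) = ?\<phi> x \<otimes> ?\<phi> y"
      using gh by (simp add: int_pow_mult m_assoc)
  qed (use gh in auto)
  then interpret \<phi>: group_hom ?Z G ?\<phi>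
    by (simp add: group_hom_def group_hom_axioms_def Z.is_group is_group)
  show ?thesis
    using gh unfolding pontryagin_def Let_def
    by (simp add: Z.pontryagin_product_1_1 \<phi>.homology_map_class bar_map_diff \<phi>.bar_map_bar
        del: One_nat_def)
qed

section \<open>The Hopf map\<close>

text \<open>The value at an inverse letter is forced by \<open>\<sigma>(x) = 0\<close> and
  \<open>0 = \<sigma>(x x\<^sup>-\<^sup>1) = \<sigma>(x) + \<sigma>(x\<^sup>-\<^sup>1) + [x|x\<^sup>-\<^sup>1]\<close>, up to a boundary.\<close>

fun bar_lift :: "('c, 'd) monoid_scheme \<Rightarrow> ((bool \<times> 'a) list \<Rightarrow> 'c) \<Rightarrow> (bool \<times> 'a) list \<Rightarrow> ('c list \<Rightarrow>\<^sub>0 int)"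
  where
  "bar_lift G p [] = 0"
| "bar_lift G p (l # w) =
     (if fst l then - bar G [p [l], p [inv_letter l]] else 0) + bar_lift G p w + bar G [p [l], p w]"

text \<open>The cochain \<open>\<sigma>\<close> trivializes, after pulling back along \<open>p\<close>, the tautological 2-cocycle
  \<open>(g, h) \<mapsto> [g|h]\<close> with values in chains modulo boundaries.\<close>

locale bar_trivialization = group_hom F G p
  for F (structure) and G (structure) and p +
  fixes \<sigma> :: "'a \<Rightarrow> ('c list \<Rightarrow>\<^sub>0 int)"
  assumes lift_mult: "u \<in> carrier F \<Longrightarrow> v \<in> carrier F \<Longrightarrow>
    \<sigma> (u \<otimes>\<^bsub>F\<^esub> v) - (\<sigma> u + \<sigma> v + bar G [p u, p v]) \<in> bar_boundaries 2 G"

text \<open>Multiplicativity of the lift when the left factor is one letter. Without cancellation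
  this is the recursion for \<open>bar_lift\<close>; with cancellation the defect is a combination
  of face sums.\<close>

lemma bar_lift_push_letter:
  assumes "group_hom (free_group S) G p" and l: "[l] \<in> carrier (free_group S)"
    and w: "w \<in> carrier (free_group S)"
  shows "bar_lift G p (push_letter l w) - (bar_lift G p [l] + bar_lift G p w + bar G [p [l], p w])
    \<in> bar_boundaries 2 G"
proof -
  interpret p: group_hom "free_group S" G p by fact
  have p_Nil [simp]: "p [] = \<one>\<^bsub>G\<^esub>"
    using p.hom_one by (simp add: free_group_def)
  show ?thesis
  proof (cases "w \<noteq> [] \<and> hd w = inv_letter l")
    case True
    then obtain w' where w': "w = inv_letter l # w'" by (cases w) auto
    define a b c where "a = p [l]" and "b = p [inv_letter l]" and "c = p w'"
    have il: "[inv_letter l] \<in> carrier (free_group S)" and cw: "w' \<in> carrier (free_group S)"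
      and eq: "w = [inv_letter l] \<otimes>\<^bsub>free_group S\<^esub> w'"
      using free_group_Cons w unfolding w' by blast+
    have abc: "a \<in> carrier G" "b \<in> carrier G" "c \<in> carrier G"
      using l il cw by (auto simp: a_def b_def c_def)
    have pw: "p w = b \<otimes>\<^bsub>G\<^esub> c"
      using il cw by (simp add: b_def c_def eq)
    have "[l] \<otimes>\<^bsub>free_group S\<^esub> [inv_letter l] = \<one>\<^bsub>free_group S\<^esub>"
      by (simp add: free_group_def)
    then have ab: "a \<otimes>\<^bsub>G\<^esub> b = \<one>\<^bsub>G\<^esub>"
      using l il unfolding a_def b_def by (metis p.hom_mult p.hom_one)
    then have ba: "b \<otimes>\<^bsub>G\<^esub> a = \<one>\<^bsub>G\<^esub>"
      using abc p.H.inv_comm by blast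
    have face: "bar_face_sum G [a, b, c] \<in> bar_boundaries 2 G" "bar_face_sum G [a, b, a] \<in> bar_boundaries 2 G"
      using abc by (auto intro!: p.H.bar_face_sum_3_boundary)
    \<comment> \<open>The correction term of \<open>bar_lift\<close> is \<open>[a|b]\<close> if
      \<open>l\<close> is an inverse letter and \<open>[b|a]\<close> otherwise. The face sum of
      \<open>[a, b, a]\<close> is the difference of these two symbols.\<close>
    have "bar_lift G p (push_letter l w) - (bar_lift G p [l] + bar_lift G p w + bar G [p [l], p w])
      = (if fst l then - bar_face_sum G [a, b, c]
         else bar_face_sum G [a, b, a] - bar_face_sum G [a, b, c])"
      unfolding pw using ab ba
      by (simp add: w' bar_face_sum_3 flip: a_def b_def c_def)
    then show ?thesis
      using face by (auto intro: bar_boundaries_uminus bar_boundaries_diff)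
  next
    case False
    then have "push_letter l w = l # w"
      by (cases w) auto
    then show ?thesis by simp
  qed
qed

lemma bar_trivialization_free_group:
  assumes "group_hom (free_group S) G p"
  shows "bar_trivialization (free_group S) G p (bar_lift G p)"
proof -
  interpret p: group_hom "free_group S" G p by fact
  have p_Nil [simp]: "p [] = \<one>\<^bsub>G\<^esub>"
    using p.hom_one by (simp add: free_group_def)
  show ?thesis
  proof
    fix u v assume "u \<in> carrier (free_group S)" and v: "v \<in> carrier (free_group S)"
    then show "bar_lift G p (u \<otimes>\<^bsub>free_group S\<^esub> v) - (bar_lift G p u + bar_lift G p v + bar G [p u, p v])
      \<in> bar_boundaries 2 G"
    proof (induction u)
      case Nil
      then show ?case by (simp add: free_group_def)
    next
      case (Cons l u)
      note lu = free_group_Cons[OF Cons.prems(1)]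
      let ?uv = "u \<otimes>\<^bsub>free_group S\<^esub> v"
      have uv: "?uv \<in> carrier (free_group S)"
        using lu v by simp
      have plu: "p (l # u) = p [l] \<otimes>\<^bsub>G\<^esub> p u"
        using lu by (metis p.hom_mult)
      have puv: "p ?uv = p u \<otimes>\<^bsub>G\<^esub> p v"
        using lu v by simp
      have push: "(l # u) \<otimes>\<^bsub>free_group S\<^esub> v = push_letter l ?uv"
        by (simp add: free_group_def)
      \<comment> \<open>The defect splits into the defect of pushing \<open>l\<close>, the one
        covered by the induction hypothesis, and the cocycle relation for \<open>l\<close>,
        \<open>u\<close>, \<open>v\<close>.\<close>
      have eq: "bar_lift G p (push_letter l ?uv)
          - (bar_lift G p (l # u) + bar_lift G p v + bar G [p (l # u), p v])
        = (bar_lift G p (push_letter l ?uv) - (bar_lift G p [l] + bar_lift G p ?uv + bar G [p [l], p ?uv]))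
          + (bar_lift G p ?uv - (bar_lift G p u + bar_lift G p v + bar G [p u, p v]))
          + bar_face_sum G [p [l], p u, p v]"
        unfolding plu by (simp add: bar_face_sum_3 puv)
      then show ?case
        unfolding push eq
        by (intro bar_boundaries_add bar_lift_push_letter[OF assms] Cons.IH
            p.H.bar_face_sum_3_boundary) (use lu v uv in simp_all)
    qed
  qed
qed

section \<open>Products of commutators and their Hopf chains\<close>

lemma (in group) commutator_closed [simp]:
  "x \<in> carrier G \<Longrightarrow> y \<in> carrier G \<Longrightarrow> commutator G x y \<in> carrier G"
  by (simp add: commutator_def)

lemma (in group_hom) hom_commutator:
  "x \<in> carrier G \<Longrightarrow> y \<in> carrier G \<Longrightarrow> h (commutator G x y) = commutator H (h x) (h y)"
  by (simp add: commutator_def)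

lemma (in group) comm_prod_closed:
  "set ps \<subseteq> carrier G \<times> carrier G \<Longrightarrow> comm_prod G ps \<in> carrier G"
  by (induction ps) (auto simp: comm_prod_def)

lemma (in group) comm_prod_snoc:
  assumes "set ps \<subseteq> carrier G \<times> carrier G" "x \<in> carrier G" "y \<in> carrier G"
  shows "comm_prod G (ps @ [(x, y)]) = comm_prod G ps \<otimes> commutator G x y"
  using assms
proof (induction ps)
  case (Cons p ps)
  then show ?case
    using comm_prod_closed[of ps] by (cases p) (auto simp: comm_prod_def m_assoc)
qed (simp add: comm_prod_def)

lemma (in group_hom) hom_comm_prod:
  "set ps \<subseteq> carrier G \<times> carrier G \<Longrightarrow>
    h (comm_prod G ps) = comm_prod H (map (\<lambda>(x, y). (h x, h y)) ps)"
  by (induction ps) (auto simp: comm_prod_def hom_commutator dest: G.comm_prod_closed[unfolded comm_prod_def])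

lemma hopf_chain_snoc:
  "hopf_chain G (ps @ [(g, h)]) = hopf_chain G ps
     + (bar G [comm_prod G ps, g] + bar G [comm_prod G ps \<otimes>\<^bsub>G\<^esub> g, h]
        - bar G [comm_prod G ps \<otimes>\<^bsub>G\<^esub> g \<otimes>\<^bsub>G\<^esub> h \<otimes>\<^bsub>G\<^esub> inv\<^bsub>G\<^esub> g, g]
        - bar G [comm_prod G (ps @ [(g, h)]), h])"
proof -
  have "(\<Sum>k<length ps. let x = fst ((ps @ [(g, h)]) ! k); y = snd ((ps @ [(g, h)]) ! k);
          I = (\<lambda>k. comm_prod G (take k (ps @ [(g, h)])))
        in bar G [I k, x] + bar G [I k \<otimes>\<^bsub>G\<^esub> x, y]
           - bar G [I k \<otimes>\<^bsub>G\<^esub> x \<otimes>\<^bsub>G\<^esub> y \<otimes>\<^bsub>G\<^esub> inv\<^bsub>G\<^esub> x, x] - bar G [I (Suc k), y]) = hopf_chain G ps"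
    unfolding hopf_chain_def by (rule sum.cong) (auto simp: nth_append Let_def)
  then show ?thesis
    by (simp add: hopf_chain_def Let_def)
qed

context bar_trivialization
begin

lemma lift_one: "\<sigma> \<one>\<^bsub>F\<^esub> \<in> bar_boundaries 2 G"
  using lift_mult[of "\<one>\<^bsub>F\<^esub>" "\<one>\<^bsub>F\<^esub>"] bar_boundaries_uminus by fastforce

text \<open>This identifies a summand of the Hopf chain as an increment of \<sigma>. Its four bar
  symbols come from the four multiplications in \<open>z x y = w y x\<close>, two on each
  side.\<close>

lemma lift_mult_commutator:
  assumes z: "z \<in> carrier F" and x: "x \<in> carrier F" and y: "y \<in> carrier F"
  defines "w \<equiv> z \<otimes>\<^bsub>F\<^esub> commutator F x y"
  shows "\<sigma> w - (\<sigma> z + (bar G [p z, p x] + bar G [p z \<otimes>\<^bsub>G\<^esub> p x, p y]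
    - bar G [p z \<otimes>\<^bsub>G\<^esub> p x \<otimes>\<^bsub>G\<^esub> p y \<otimes>\<^bsub>G\<^esub> inv\<^bsub>G\<^esub> p x, p x] - bar G [p w, p y])) \<in> bar_boundaries 2 G"
    (is "?d \<in> _")
proof -
  define e where "e = (\<lambda>u v. \<sigma> (u \<otimes>\<^bsub>F\<^esub> v) - (\<sigma> u + \<sigma> v + bar G [p u, p v]))"
  have w: "w \<in> carrier F"
    using x y z by (simp add: w_def)
  have wy: "w \<otimes>\<^bsub>F\<^esub> y = z \<otimes>\<^bsub>F\<^esub> x \<otimes>\<^bsub>F\<^esub> y \<otimes>\<^bsub>F\<^esub> inv\<^bsub>F\<^esub> x"
    using x y z by (simp add: w_def commutator_def G.m_assoc)
  then have wyx: "w \<otimes>\<^bsub>F\<^esub> y \<otimes>\<^bsub>F\<^esub> x = z \<otimes>\<^bsub>F\<^esub> x \<otimes>\<^bsub>F\<^esub> y"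
    using x y z by (simp add: G.m_assoc)
  \<comment> \<open>Inverses are avoided by evaluating \<open>\<sigma>\<close> on both sides of \<open>w y x = z x y\<close>.\<close>
  have "?d = e z x + e (z \<otimes>\<^bsub>F\<^esub> x) y - e w y - e (w \<otimes>\<^bsub>F\<^esub> y) x"
    unfolding e_def wyx using x y z w by (simp add: wy)
  moreover have "\<dots> \<in> bar_boundaries 2 G"
    unfolding e_def using x y z w by (intro bar_boundaries_add bar_boundaries_diff lift_mult) auto
  ultimately show ?thesis by simp
qed

text \<open>Appending one commutator at a time, the increments of \<sigma> add up to the Hopf
  chain.\<close>

lemma lift_comm_prod:
  assumes "set ps \<subseteq> carrier F \<times> carrier F"
  shows "\<sigma> (comm_prod F ps) - hopf_chain G (map (\<lambda>(x, y). (p x, p y)) ps) \<in> bar_boundaries 2 G"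
  using assms
proof (induction ps rule: rev_induct)
  case Nil
  show ?case using lift_one by (simp add: comm_prod_def hopf_chain_def)
next
  case (snoc q ps)
  obtain x y where q: "q = (x, y)" by fastforce
  have xy: "x \<in> carrier F" "y \<in> carrier F" and ps: "set ps \<subseteq> carrier F \<times> carrier F"
    using snoc.prems by (auto simp: q)
  have z: "comm_prod F ps \<in> carrier F"
    using ps by (rule G.comm_prod_closed)
  have "comm_prod G (map (\<lambda>(x, y). (p x, p y)) ps @ [(p x, p y)])
      = p (comm_prod F ps \<otimes>\<^bsub>F\<^esub> commutator F x y)"
    using ps xy hom_comm_prod[of "ps @ [(x, y)]"] by (simp add: G.comm_prod_snoc)
  then show ?case
    using bar_boundaries_add[OF snoc.IH[OF ps] lift_mult_commutator[OF z xy]] ps xy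
    by (simp add: q hopf_chain_snoc hom_comm_prod G.comm_prod_snoc algebra_simps)
qed

lemma lift_mult_kernel:
  assumes "k \<in> carrier F" "p k = \<one>\<^bsub>G\<^esub>" "\<sigma> k \<in> bar_boundaries 2 G" "u \<in> carrier F"
  shows "\<sigma> (k \<otimes>\<^bsub>F\<^esub> u) - \<sigma> u \<in> bar_boundaries 2 G"
  using bar_boundaries_add[OF lift_mult[OF assms(1,4)] assms(3)] assms(2) by simp

text \<open>The three conclusions are proved together because \<sigma> is additive modulo boundaries
  only on the kernel of \<open>p\<close>, where the term \<open>[p u|p v]\<close> is
  degenerate.\<close>

lemma lift_commutator_subgroup:
  assumes R: "R \<subseteq> carrier F" "\<And>r. r \<in> R \<Longrightarrow> p r = \<one>\<^bsub>G\<^esub>"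
    and "k \<in> commutator_subgroup F (carrier F) R"
  shows "k \<in> carrier F \<and> p k = \<one>\<^bsub>G\<^esub> \<and> \<sigma> k \<in> bar_boundaries 2 G"
proof -
  have comm: "c \<in> carrier F \<and> p c = \<one>\<^bsub>G\<^esub> \<and> \<sigma> c \<in> bar_boundaries 2 G"
    if c_in: "c \<in> {commutator F h r | h r. h \<in> carrier F \<and> r \<in> R}" for c
  proof -
    obtain x r where c: "c = commutator F x r" and x: "x \<in> carrier F" and r: "r \<in> R"
      using c_in by auto
    have pr: "r \<in> carrier F" "p r = \<one>\<^bsub>G\<^esub>"
      using r R by auto
    \<comment> \<open>With \<open>z\<close> the identity and \<open>p r\<close> trivial, all four
      bar symbols of the increment contain the identity.\<close>
    have "\<sigma> c - \<sigma> \<one>\<^bsub>F\<^esub> \<in> bar_boundaries 2 G"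
      using lift_mult_commutator[OF G.one_closed x pr(1)] x pr by (simp add: c)
    then have "\<sigma> c \<in> bar_boundaries 2 G"
      using bar_boundaries_add[OF _ lift_one] by fastforce
    then show ?thesis
      using x pr by (simp add: c hom_commutator) (simp add: commutator_def)
  qed
  show ?thesis
    using assms(3) unfolding commutator_subgroup_def
  proof (induction rule: generate.induct)
    case one
    show ?case using lift_one by simp
  next
    case (incl c)
    then show ?case by (rule comm)
  next
    case (inv c)
    note c = comm[OF inv]
    then have "\<sigma> \<one>\<^bsub>F\<^esub> - (\<sigma> (inv\<^bsub>F\<^esub> c) + \<sigma> c) \<in> bar_boundaries 2 G"
      using lift_mult[of "inv\<^bsub>F\<^esub> c" c] by simp
    from bar_boundaries_diff[OF lift_one bar_boundaries_add[OF this]]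
    have "\<sigma> (inv\<^bsub>F\<^esub> c) \<in> bar_boundaries 2 G"
      using c by fastforce
    then show ?case using c by simp
  next
    case (eng c d)
    then have "\<sigma> (c \<otimes>\<^bsub>F\<^esub> d) - \<sigma> d \<in> bar_boundaries 2 G"
      by (intro lift_mult_kernel) auto
    from bar_boundaries_add[OF this, of "\<sigma> d"] show ?case
      using eng by auto
  qed
qed

end

text \<open>The definite description denotes because the Hopf chain of every admissible list agrees,
  modulo boundaries, with the lift of the fixed element \<open>r\<close>.\<close>

lemma hopf_map_hopf_class:
  assumes "R \<lhd> free_group S" and r: "r \<in> carrier (free_group S)"
    and ps: "set ps \<subseteq> carrier (free_group S) \<times> carrier (free_group S)"
    and ps_r: "comm_prod (free_group S) ps \<in> hopf_class (free_group S) R r"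
  shows "hopf_map (free_group S) R (hopf_class (free_group S) R r) =
    homology_class 2 (free_group S Mod R) (hopf_chain (free_group S Mod R)
      (map (\<lambda>(x, y). (R #>\<^bsub>free_group S\<^esub> x, R #>\<^bsub>free_group S\<^esub> y)) ps))"
proof -
  let ?F = "free_group S" and ?G = "free_group S Mod R" and ?p = "\<lambda>x. R #>\<^bsub>free_group S\<^esub> x"
  let ?chain = "\<lambda>ps. hopf_chain ?G (map (\<lambda>(x, y). (?p x, ?p y)) ps)"
  interpret R: normal R ?F by fact
  have "group_hom ?F ?G ?p"
    by (simp add: group_hom_def group_hom_axioms_def R.is_group R.factorgroup_is_group R.r_coset_hom_Mod)
  then interpret bar_trivialization ?F ?G ?p "bar_lift ?G ?p"
    by (rule bar_trivialization_free_group)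
  let ?\<sigma> = "bar_lift ?G ?p"
  have ker: "?p k = \<one>\<^bsub>?G\<^esub>" if "k \<in> R" for k
    using that by (simp add: FactGroup_def R.rcos_const)
  have chain: "?\<sigma> r - ?chain qs \<in> bar_boundaries 2 ?G"
    if qs: "set qs \<subseteq> carrier ?F \<times> carrier ?F" "comm_prod ?F qs \<in> hopf_class ?F R r" for qs
  proof -
    obtain k where k: "k \<in> commutator_subgroup ?F (carrier ?F) R" "comm_prod ?F qs = k \<otimes>\<^bsub>?F\<^esub> r"
      using qs(2) by (auto simp: hopf_class_def r_coset_def)
    have "?\<sigma> (comm_prod ?F qs) - ?\<sigma> r \<in> bar_boundaries 2 ?G"
      using lift_commutator_subgroup[OF R.subset ker k(1)] r unfolding k(2)
      by (auto intro: lift_mult_kernel)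
    from bar_boundaries_diff[OF lift_comm_prod[OF qs(1)] this] show ?thesis by simp
  qed
  have unique: "homology_class 2 ?G (?chain qs) = homology_class 2 ?G (?chain ps)"
    if "set qs \<subseteq> carrier ?F \<times> carrier ?F" "comm_prod ?F qs \<in> hopf_class ?F R r" for qs
    using bar_boundaries_diff[OF chain[OF ps ps_r] chain[OF that]]
    by (intro homology_class_cong) simp
  show ?thesis
    unfolding hopf_map_def
  proof (rule the_equality)
    show "\<exists>qs. set qs \<subseteq> carrier ?F \<times> carrier ?F \<and> comm_prod ?F qs \<in> hopf_class ?F R r \<and>
        homology_class 2 ?G (?chain ps) = homology_class 2 ?G (?chain qs)"
      using ps ps_r by blast
  qed (use unique in blast)
qed

section \<open>Central commutators and alternating products\<close>

lemma (in group) commutator_eq_mult_inv: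
  "x \<in> carrier G \<Longrightarrow> y \<in> carrier G \<Longrightarrow> commutator G x y = (x \<otimes> y) \<otimes> inv (y \<otimes> x)"
  by (simp add: commutator_def m_assoc inv_mult_group)

lemma (in group) commutator_eq_one_iff:
  assumes "x \<in> carrier G" "y \<in> carrier G"
  shows "commutator G x y = \<one> \<longleftrightarrow> x \<otimes> y = y \<otimes> x"
  using assms by (simp add: commutator_eq_mult_inv) (metis inv_solve_right l_one m_closed one_closed)

lemma (in group) conjugate_commutator:
  assumes "g \<in> carrier G" "x \<in> carrier G" "y \<in> carrier G"
  shows "g \<otimes> commutator G x y \<otimes> inv g = commutator G (g \<otimes> x \<otimes> inv g) (g \<otimes> y \<otimes> inv g)"
proof -
  have cancel: "inv g \<otimes> (g \<otimes> u) = u" if "u \<in> carrier G" for u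
    using that assms by (simp flip: m_assoc)
  show ?thesis
    using assms by (simp add: commutator_def m_assoc inv_mult_group cancel)
qed

text \<open>Conjugation maps each generating commutator to another one, as \<open>R\<close> is
  normal; the generated subgroup inherits this.\<close>

lemma (in group) normal_commutator_subgroup:
  assumes "R \<lhd> G"
  shows "commutator_subgroup G (carrier G) R \<lhd> G"
proof -
  interpret R: normal R G by fact
  let ?S = "{commutator G h k |h k. h \<in> carrier G \<and> k \<in> R}"
  have S: "?S \<subseteq> carrier G"
    using R.subset by auto
  have conj: "g \<otimes> c \<otimes> inv g \<in> ?S" if c: "c \<in> ?S" and g: "g \<in> carrier G" for c g
  proof -
    obtain h k where "c = commutator G h k" "h \<in> carrier G" "k \<in> R"
      using c by auto
    then have "g \<otimes> c \<otimes> inv g = commutator G (g \<otimes> h \<otimes> inv g) (g \<otimes> k \<otimes> inv g)"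
      "g \<otimes> h \<otimes> inv g \<in> carrier G" "g \<otimes> k \<otimes> inv g \<in> R"
      using g R.subset by (auto simp: conjugate_commutator R.inv_op_closed2)
    then show ?thesis by blast
  qed
  show ?thesis
    unfolding commutator_subgroup_def
  proof (rule normal_invI)
    show "subgroup (generate G ?S) G"
      using S by (rule generate_is_subgroup)
    fix g c assume g: "g \<in> carrier G" and "c \<in> generate G ?S"
    from this(2) show "g \<otimes> c \<otimes> inv g \<in> generate G ?S"
    proof (induction rule: generate.induct)
      case one
      show ?case using g generate.one by simp
    next
      case (incl c)
      then show ?case using g by (intro generate.incl conj)
    next
      case (inv c)
      then have "c \<in> carrier G" using S by blast
      then have "g \<otimes> inv c \<otimes> inv g = inv (g \<otimes> c \<otimes> inv g)"
        using g by (simp add: inv_mult_group m_assoc)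
      then show ?case
        using generate.inv[OF conj[OF inv g]] by metis
    next
      case (eng c d)
      then have "c \<in> carrier G" "d \<in> carrier G"
        using generate_in_carrier[OF S] by blast+
      then have "g \<otimes> (c \<otimes> d) \<otimes> inv g = (g \<otimes> c \<otimes> inv g) \<otimes> (g \<otimes> d \<otimes> inv g)"
        using g by (simp add: m_assoc) (simp flip: m_assoc)
      then show ?case
        using generate.eng[OF eng.IH] by metis
    qed
  qed
qed

lemma (in group) commutator_subgroup_subset:
  assumes "R \<lhd> G"
  shows "commutator_subgroup G (carrier G) R \<subseteq> R"
proof -
  interpret R: normal R G by fact
  have "commutator G h k \<in> R" if "h \<in> carrier G" "k \<in> R" for h k
  proof -
    have "commutator G h k = (h \<otimes> k \<otimes> inv h) \<otimes> inv k"
      by (simp add: commutator_def)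
    then show ?thesis
      using that by (simp add: R.inv_op_closed2)
  qed
  then show ?thesis
    unfolding commutator_subgroup_def by (intro generate_subgroup_incl) (auto intro: R.subgroup_axioms)
qed

section \<open>Alternating products and their commutators\<close>

lemma (in group) alt_prod_closed:
  "g \<in> carrier G \<Longrightarrow> h \<in> carrier G \<Longrightarrow> alt_prod G g h m \<in> carrier G"
  by (induction m arbitrary: g h) auto

lemma (in group_hom) hom_alt_prod:
  "x \<in> carrier G \<Longrightarrow> y \<in> carrier G \<Longrightarrow> h (alt_prod G x y m) = alt_prod H (h x) (h y) m"
  by (induction m arbitrary: x y) (auto simp: G.alt_prod_closed)

lemma (in group) alt_prod_even:
  assumes "g \<in> carrier G" "h \<in> carrier G"
  shows "alt_prod G g h (2 * m) = (g \<otimes> h) [^] m"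
proof (induction m)
  case (Suc m)
  then show ?case
    using assms nat_pow_Suc2[of "g \<otimes> h" m] by (simp add: m_assoc)
qed simp

text \<open>The recursion adds letters in front, whereas here a letter is appended at the end. The
  induction therefore adds the pair \<open>g\<close>, \<open>h\<close> in front at each
  step.\<close>

lemma (in group) alt_prod_odd_mult:
  assumes "g \<in> carrier G" "h \<in> carrier G"
  shows "alt_prod G g h (Suc (2 * m)) \<otimes> h = (g \<otimes> h) [^] Suc m"
proof (induction m)
  case (Suc m)
  have "alt_prod G g h (Suc (2 * Suc m)) \<otimes> h = (g \<otimes> h) \<otimes> (alt_prod G g h (Suc (2 * m)) \<otimes> h)"
    using assms by (simp add: m_assoc alt_prod_closed)
  then show ?case
    unfolding Suc.IH using assms nat_pow_Suc2[of "g \<otimes> h" "Suc m"] by simp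
qed (use assms in simp)

text \<open>Multiplying the odd alternating product by \<open>a\<close> on either side completes it
  to \<open>2 * m\<close> alternating letters, which is a power of \<open>a b\<close> or of
  \<open>b a\<close>.\<close>

lemma (in group) commutator_alt_prod:
  assumes "a \<in> carrier G" "b \<in> carrier G" "0 < m"
  shows "commutator G a (alt_prod G b a (2 * m - 1)) = (a \<otimes> b) [^] m \<otimes> inv ((b \<otimes> a) [^] m)"
proof -
  obtain k where m: "m = Suc k"
    using assms(3) gr0_conv_Suc by blast
  have "a \<otimes> alt_prod G b a (Suc (2 * k)) = (a \<otimes> b) [^] m"
    using alt_prod_even[OF assms(1,2), of m] by (simp add: m)
  moreover have "alt_prod G b a (Suc (2 * k)) \<otimes> a = (b \<otimes> a) [^] m"
    using alt_prod_odd_mult[OF assms(2,1), of k] by (simp add: m)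
  ultimately show ?thesis
    using assms by (simp add: commutator_eq_mult_inv alt_prod_closed m del: alt_prod.simps)
qed

text \<open>Both \<open>a b b a\<close> and \<open>b a a b\<close> equal \<open>b b a a\<close>, so
  \<open>a b\<close> and \<open>b a\<close> commute and the power distributes over
  \<open>(a b) (b a)\<^sup>-\<^sup>1\<close>.\<close>

lemma (in group) pow_mult_inv_pow_eq_commutator_pow:
  assumes a: "a \<in> carrier G" and b: "b \<in> carrier G"
    and "b \<otimes> (a \<otimes> a) = (a \<otimes> a) \<otimes> b" "a \<otimes> (b \<otimes> b) = (b \<otimes> b) \<otimes> a"
  shows "(a \<otimes> b) [^] (m::nat) \<otimes> inv ((b \<otimes> a) [^] m) = commutator G a b [^] m"
proof -
  have "(a \<otimes> b) \<otimes> (b \<otimes> a) = (b \<otimes> b) \<otimes> (a \<otimes> a)"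
    using assms by (metis m_assoc m_closed)
  also have "\<dots> = (b \<otimes> a) \<otimes> (a \<otimes> b)"
    using assms by (metis m_assoc m_closed)
  finally have "inv (b \<otimes> a) \<otimes> (a \<otimes> b) = (a \<otimes> b) \<otimes> inv (b \<otimes> a)"
    using a b by (metis inv_solve_left inv_solve_right m_assoc m_closed inv_closed)
  then have "((a \<otimes> b) \<otimes> inv (b \<otimes> a)) [^] m = (a \<otimes> b) [^] m \<otimes> inv (b \<otimes> a) [^] m"
    using a b by (intro pow_mult_distrib) auto
  then show ?thesis
    using a b by (simp add: commutator_eq_mult_inv nat_pow_inv)
qed

lemma (in group) normal_normal_closure:
  assumes "S \<subseteq> carrier G"
  shows "normal_closure G S \<lhd> G"
proof -
  \<comment> \<open>The family of normal subgroups must be nonempty for its intersection to be a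
    subgroup.\<close>
  have G: "carrier G \<in> {N. N \<lhd> G \<and> S \<subseteq> N}"
    using assms by (simp add: normal_inv_iff subgroup_self)
  show ?thesis
    unfolding normal_closure_def
  proof (rule normal_invI)
    show "subgroup (\<Inter>{N. N \<lhd> G \<and> S \<subseteq> N}) G"
      using G by (intro subgroups_Inter) (auto dest: normal_imp_subgroup)
  qed (auto simp: normal_inv_iff)
qed

lemma subset_normal_closure: "S \<subseteq> normal_closure G S"
  by (auto simp: normal_closure_def)

text \<open>The boundary of the chain is \<open>[h g] - [g h]\<close>, which vanishes for commuting
  elements.\<close>

lemma (in group) bar_antisym_in_carrier:
  assumes "g \<in> carrier G" "h \<in> carrier G" "g \<otimes> h = h \<otimes> g"
  shows "homology_class 2 G (bar G [g, h] - bar G [h, g]) \<in> carrier (group_homology 2 G)"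
proof -
  let ?c = "bar G [g, h] - bar G [h, g]"
  have chain: "?c \<in> carrier (bar_chains 2 G)"
    using assms by (intro bar_chains_diff bar_in_bar_chains) auto
  have bd: "bar_boundary G (bar G [x, y]) = bar_face_sum G [x, y]"
    if "x \<in> carrier G" "y \<in> carrier G" for x y
  proof (cases "\<one> \<in> {x, y}")
    case True
    then consider "x = \<one>" | "y = \<one>" by blast
    then show ?thesis
      by cases (use that in \<open>simp_all add: bar_face_sum_2 bar_boundary_def\<close>)
  next
    case False
    then have "bar G [x, y] = frag_of [x, y]"
      by (simp add: bar_def)
    then show ?thesis
      by (simp add: bar_boundary_def)
  qed
  have "bar_boundary G ?c = 0"
    using assms by (simp add: bar_boundary_diff bd bar_face_sum_2)
  with chain have "?c \<in> carrier (subgroup_generated (bar_chains 2 G) (bar_cycles 2 G))"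
    by (auto simp: subgroup_generated_def bar_cycles_def intro: generate.incl)
  then show ?thesis
    by (auto simp: group_homology_def homology_class_def FactGroup_def RCOSETS_def r_coset_def)
qed

section \<open>Pontryagin products under the Hopf isomorphism\<close>

text \<open>This isolates what the argument takes from the Coxeter presentation: two squares and one
  relator lying in a normal subgroup of a free group.\<close>

lemma pontryagin_eq_hopf_map:
  fixes S :: "'a set" and i j :: 'a and m :: nat
  defines "F \<equiv> free_group S"
  assumes R: "R \<lhd> F" and ij: "i \<in> S" "j \<in> S" and m: "0 < m"
    and sq: "gen i \<otimes>\<^bsub>F\<^esub> gen i \<in> R" "gen j \<otimes>\<^bsub>F\<^esub> gen j \<in> R"
    and rel: "(gen i \<otimes>\<^bsub>F\<^esub> gen j) [^]\<^bsub>F\<^esub> m \<otimes>\<^bsub>F\<^esub> inv\<^bsub>F\<^esub> ((gen j \<otimes>\<^bsub>F\<^esub> gen i) [^]\<^bsub>F\<^esub> m) \<in> R"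
  defines "W \<equiv> F Mod R" and "s \<equiv> \<lambda>i. R #>\<^bsub>F\<^esub> gen i"
  defines "t \<equiv> alt_prod W (s j) (s i) (2 * m - 1)"
  defines "r \<equiv> commutator F (gen i) (gen j) [^]\<^bsub>F\<^esub> m"
  shows "commutator W (s i) t = \<one>\<^bsub>W\<^esub>"
    and "hopf_class F R r \<in> carrier (hopf_group F R)"
    and "pontryagin W (s i) t \<in> carrier (group_homology 2 W)"
    and "pontryagin W (s i) t = hopf_map F R (hopf_class F R r)"
proof -
  interpret F: group F
    unfolding F_def by (rule group_free_group)
  interpret R: normal R F by fact
  have proj: "group_hom F (F Mod N) (\<lambda>x. N #>\<^bsub>F\<^esub> x)" if "N \<lhd> F" for N
    using that by (simp add: group_hom_def group_hom_axioms_def F.is_group normal.factorgroup_is_group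
        normal.r_coset_hom_Mod)
  interpret p: group_hom F W "\<lambda>x. R #>\<^bsub>F\<^esub> x"
    unfolding W_def using R by (rule proj)
  \<comment> \<open>Hopf classes are cosets of \<open>K\<close>, and the image of \<open>R\<close>
    in \<open>F Mod K\<close> is central.\<close>
  define K where "K = commutator_subgroup F (carrier F) R"
  have K: "K \<lhd> F"
    unfolding K_def using R by (rule F.normal_commutator_subgroup)
  interpret K: normal K F by fact
  interpret q: group_hom F "F Mod K" "\<lambda>x. K #>\<^bsub>F\<^esub> x"
    using K by (rule proj)
  have K_R: "K \<subseteq> R"
    unfolding K_def using R by (rule F.commutator_subgroup_subset)
  \<comment> \<open>\<open>c\<close> lifts \<open>t\<close> to the free group in such a way that
    \<open>[a, c]\<close> is the relator in \<open>rel\<close>.\<close>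
  define a b c where "a = gen i" and "b = gen j" and "c = alt_prod F b a (2 * m - 1)"
  have ab: "a \<in> carrier F" "b \<in> carrier F"
    using ij by (simp_all add: a_def b_def F_def gen_in_free_group)
  have c: "c \<in> carrier F"
    using ab by (simp add: c_def F.alt_prod_closed)
  have r: "r = commutator F a b [^]\<^bsub>F\<^esub> m" and s: "s i = R #>\<^bsub>F\<^esub> a" "s j = R #>\<^bsub>F\<^esub> b"
    by (simp_all add: r_def a_def b_def s_def)
  have t: "t = R #>\<^bsub>F\<^esub> c"
    using ab by (simp add: t_def s c_def p.hom_alt_prod)
  have r_carrier: "r \<in> carrier F"
    using ab by (simp add: r)
  have ac: "commutator F a c = (a \<otimes>\<^bsub>F\<^esub> b) [^]\<^bsub>F\<^esub> m \<otimes>\<^bsub>F\<^esub> inv\<^bsub>F\<^esub> ((b \<otimes>\<^bsub>F\<^esub> a) [^]\<^bsub>F\<^esub> m)"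
    unfolding c_def using ab m by (rule F.commutator_alt_prod)
  have ac_R: "commutator F a c \<in> R"
    unfolding ac using rel by (simp add: a_def b_def)
  have one_R: "R #>\<^bsub>F\<^esub> x = \<one>\<^bsub>W\<^esub>" if "x \<in> R" for x
    using that by (simp add: W_def FactGroup_def R.rcos_const)
  have comm: "commutator W (s i) t = \<one>\<^bsub>W\<^esub>"
    using ab c one_R[OF ac_R] by (simp add: s t p.hom_commutator)
  then show "commutator W (s i) t = \<one>\<^bsub>W\<^esub>" .
  have st: "s i \<in> carrier W" "t \<in> carrier W"
    using ab c by (simp_all add: s t)
  then have st_comm: "s i \<otimes>\<^bsub>W\<^esub> t = t \<otimes>\<^bsub>W\<^esub> s i"
    using comm by (simp add: p.H.commutator_eq_one_iff)

  have q_comm: "(K #>\<^bsub>F\<^esub> x) \<otimes>\<^bsub>F Mod K\<^esub> (K #>\<^bsub>F\<^esub> y) = (K #>\<^bsub>F\<^esub> y) \<otimes>\<^bsub>F Mod K\<^esub> (K #>\<^bsub>F\<^esub> x)"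
    if x: "x \<in> carrier F" and y: "y \<in> R" for x y
  proof -
    have "commutator F x y \<in> K"
      unfolding K_def commutator_subgroup_def using that by (intro generate.incl) blast
    then have "K #>\<^bsub>F\<^esub> commutator F x y = \<one>\<^bsub>F Mod K\<^esub>"
      by (simp add: FactGroup_def K.rcos_const)
    moreover have "y \<in> carrier F" using y R.subset by blast
    ultimately show ?thesis
      using x by (metis q.hom_commutator q.hom_closed q.H.commutator_eq_one_iff)
  qed
  let ?q = "\<lambda>x. K #>\<^bsub>F\<^esub> x"
  have "?q (commutator F a c) = (?q a \<otimes>\<^bsub>F Mod K\<^esub> ?q b) [^]\<^bsub>F Mod K\<^esub> m
      \<otimes>\<^bsub>F Mod K\<^esub> inv\<^bsub>F Mod K\<^esub> ((?q b \<otimes>\<^bsub>F Mod K\<^esub> ?q a) [^]\<^bsub>F Mod K\<^esub> m)"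
    unfolding ac using ab by (simp add: q.hom_nat_pow)
  \<comment> \<open>The squares of \<open>a\<close> and \<open>b\<close> lie in \<open>R\<close>, so
    they are central modulo \<open>K\<close>.\<close>
  also have "\<dots> = commutator (F Mod K) (?q a) (?q b) [^]\<^bsub>F Mod K\<^esub> m"
    using ab sq q_comm[of b "a \<otimes>\<^bsub>F\<^esub> a"] q_comm[of a "b \<otimes>\<^bsub>F\<^esub> b"]
    by (intro q.H.pow_mult_inv_pow_eq_commutator_pow) (simp_all add: a_def b_def)
  also have "\<dots> = ?q r"
    using ab by (simp add: r q.hom_nat_pow q.hom_commutator)
  finally have "?q (commutator F a c) = ?q r" .
  \<comment> \<open>Thus the Hopf class of \<open>r\<close> has the single commutator
    \<open>[a, c]\<close> as a representative.\<close>
  then have ac_r: "commutator F a c \<in> hopf_class F R r" and r_ac: "r \<in> K #>\<^bsub>F\<^esub> commutator F a c"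
    using F.rcos_self[OF _ K.subgroup_axioms] ab c r_carrier by (auto simp: hopf_class_def simp flip: K_def)

  have "r \<in> R"
    using r_ac K_R ac_R by (auto simp: r_coset_def)
  moreover have "r \<in> derived F (carrier F)"
  proof -
    have "commutator F a b \<in> derived F (carrier F)"
      unfolding derived_def using ab by (intro generate.incl) (auto simp: commutator_def)
    moreover have "subgroup (derived F (carrier F)) F"
      by (rule F.derived_is_subgroup) simp
    ultimately show ?thesis
      unfolding r by (induction m) (auto simp: subgroup.one_closed subgroup.m_closed)
  qed
  ultimately have "r \<in> carrier (subgroup_generated F (R \<inter> derived F (carrier F)))"
    using r_carrier by (auto simp: subgroup_generated_def intro: generate.incl)
  then show "hopf_class F R r \<in> carrier (hopf_group F R)"
    by (auto simp: hopf_group_def hopf_class_def FactGroup_def RCOSETS_def r_coset_def)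

  have pont: "pontryagin W (s i) t = homology_class 2 W (bar W [s i, t] - bar W [t, s i])"
    using st st_comm by (rule p.H.pontryagin_eq)
  then show "pontryagin W (s i) t \<in> carrier (group_homology 2 W)"
    using p.H.bar_antisym_in_carrier[OF st st_comm] by simp

  have "hopf_map F R (hopf_class F R r) = homology_class 2 W (hopf_chain W [(s i, t)])"
    using hopf_map_hopf_class[of R S r "[(a, c)]", folded F_def] R r_carrier ab c ac_r
    by (simp add: W_def s t comm_prod_def)
  \<comment> \<open>Both partial products \<open>I 0\<close> and \<open>I 1\<close> are trivial,
    which removes the first and last symbols; commutation turns the third into
    \<open>[t|s i]\<close>.\<close>
  also have "hopf_chain W [(s i, t)] = bar W [s i, t] - bar W [t, s i]"
  proof -
    have "comm_prod W [(s i, t)] = \<one>\<^bsub>W\<^esub>"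
      by (simp add: comm_prod_def comm)
    moreover have "s i \<otimes>\<^bsub>W\<^esub> t \<otimes>\<^bsub>W\<^esub> inv\<^bsub>W\<^esub> s i = t"
      using st st_comm by (simp add: p.H.m_assoc)
    ultimately show ?thesis
      using st hopf_chain_snoc[of W "[]" "s i" t] by (simp add: comm_prod_def hopf_chain_def)
  qed
  finally show "pontryagin W (s i) t = hopf_map F R (hopf_class F R r)"
    using pont by simp
qed

text \<open>\<open>pontryagin\<close> is a union and \<open>hopf_map\<close> a definite description,
  so both are total. The two membership clauses certify that the equation compares genuine elements
  of the Hopf quotient and of the second homology group.\<close>

theorem theorem7p2:
  fixes n :: nat and M :: "nat \<Rightarrow> nat \<Rightarrow> enat"
  assumes "n \<ge> 1"
    and "even_coxeter_matrix n M"
  defines "F \<equiv> coxeter_free n"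
    and "R \<equiv> even_coxeter_rel n M"
    and "W \<equiv> even_coxeter_group n M"
    and "s \<equiv> coxeter_gen n M"
  shows "\<forall>(i, j) \<in> finite_pairs n M.
           commutator W (s i) (alt_prod W (s j) (s i) (2 * half_exp M i j - 1)) = \<one>\<^bsub>W\<^esub> \<and>
           hopf_class F R (commutator F (gen i) (gen j) [^]\<^bsub>F\<^esub> half_exp M i j)
             \<in> carrier (hopf_group F R) \<and>
           pontryagin W (s i) (alt_prod W (s j) (s i) (2 * half_exp M i j - 1))
             \<in> carrier (group_homology 2 W) \<and>
           pontryagin W (s i) (alt_prod W (s j) (s i) (2 * half_exp M i j - 1))
             = hopf_map F R (hopf_class F R (commutator F (gen i) (gen j) [^]\<^bsub>F\<^esub> half_exp M i j))"
proof -
  interpret F: group F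
    unfolding F_def coxeter_free_def by (rule group_free_group)
  have gens: "gen i \<in> carrier F" if "i \<in> {1..n}" for i
    unfolding F_def coxeter_free_def using that by (rule gen_in_free_group)
  have rels: "even_coxeter_relators n M \<subseteq> carrier F"
    by (auto simp: even_coxeter_relators_def Let_def finite_pairs_def gens simp flip: F_def)
  have R: "R \<lhd> F"
    unfolding R_def even_coxeter_rel_def F_def[symmetric]
    using rels by (rule F.normal_normal_closure)
  have rels_R: "even_coxeter_relators n M \<subseteq> R"
    unfolding R_def even_coxeter_rel_def by (rule subset_normal_closure)
  have W: "W = F Mod R" and s: "s = (\<lambda>i. R #>\<^bsub>F\<^esub> gen i)"
    by (simp_all add: W_def even_coxeter_group_def F_def R_def s_def coxeter_gen_def fun_eq_iff)
  have main: "commutator W (s i) (alt_prod W (s j) (s i) (2 * half_exp M i j - 1)) = \<one>\<^bsub>W\<^esub> \<and>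
           hopf_class F R (commutator F (gen i) (gen j) [^]\<^bsub>F\<^esub> half_exp M i j)
             \<in> carrier (hopf_group F R) \<and>
           pontryagin W (s i) (alt_prod W (s j) (s i) (2 * half_exp M i j - 1))
             \<in> carrier (group_homology 2 W) \<and>
           pontryagin W (s i) (alt_prod W (s j) (s i) (2 * half_exp M i j - 1))
             = hopf_map F R (hopf_class F R (commutator F (gen i) (gen j) [^]\<^bsub>F\<^esub> half_exp M i j))"
    if ij: "(i, j) \<in> finite_pairs n M" for i j
  proof -
    have range: "i \<in> {1..n}" "j \<in> {1..n}" "i \<noteq> j" and fin: "M i j \<noteq> \<infinity>"
      using ij by (auto simp: finite_pairs_def)
    then obtain m where m: "M i j = enat m" "even m" "2 \<le> M i j"
      using assms(2) unfolding even_coxeter_matrix_def coxeter_matrix_def by metis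
    then have "2 \<le> m"
      by (metis enat_ord_simps(1) numeral_eq_enat)
    \<comment> \<open>Off-diagonal entries are at least 2, so halving gives at least 1 and the
      subtraction in \<open>2 * half_exp M i j - 1\<close> is not truncated.\<close>
    then have pos: "0 < half_exp M i j"
      by (simp add: half_exp_def m(1))
    have sq: "gen k \<otimes>\<^bsub>F\<^esub> gen k \<in> R" if k: "k \<in> {1..n}" for k
    proof -
      have "gen k [^]\<^bsub>F\<^esub> (2::nat) \<in> R"
        using k rels_R by (auto simp: even_coxeter_relators_def Let_def simp flip: F_def)
      then show ?thesis
        using gens[OF k] by (simp add: numeral_2_eq_2)
    qed
    have rel: "(gen i \<otimes>\<^bsub>F\<^esub> gen j) [^]\<^bsub>F\<^esub> half_exp M i j
        \<otimes>\<^bsub>F\<^esub> inv\<^bsub>F\<^esub> ((gen j \<otimes>\<^bsub>F\<^esub> gen i) [^]\<^bsub>F\<^esub> half_exp M i j) \<in> R"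
      using ij rels_R unfolding even_coxeter_relators_def Let_def F_def[symmetric] by blast
    show ?thesis
      using pontryagin_eq_hopf_map[OF R[unfolded F_def coxeter_free_def] range(1,2) pos
          sq[OF range(1), unfolded F_def coxeter_free_def] sq[OF range(2), unfolded F_def coxeter_free_def]
          rel[unfolded F_def coxeter_free_def], folded coxeter_free_def, folded F_def]
      unfolding W s by blast
  qed
  show ?thesis
    using main by blast
qed

end
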